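(* Let $A=[A_1,\;A_2]\in\mathbb{R}^{m\times(t+N^2)}$ be the constraint matrix of the conic program obtained from the sum-of-squares program $$\min_{u,s}\ w^{\mathsf T}u\quad\text{s.t.}\quad s(x)=g_0(x)-\sum_{i=1}^t u_i g_i(x),\quad s\in\Sigma[x]_{n,2d},$$ by modeling it using the monomial basis $v_d(x)$, where $A_1$, $A_2$ are defined as in the context. Then the $m\times m$ matrix $AA^{\mathsf T}$ is of the "diagonal plus low rank" form. Precisely, $D:=A_2A_2^{\mathsf T}$ is diagonal and $AA^{\mathsf T}=D+A_1A_1^{\mathsf T}$.
   Context: Let $n,d,t$ be given natural numbers. For $\alpha\in\mathbb{N}^n$ write $|\alpha|=\sum_i\alpha_i$ and $x^\alpha=x_1^{\alpha_1}\cdots x_n^{\alpha_n}$; let $\mathbb{N}^n_d=\{\alpha\in\mathbb{N}^n:|\alpha|\le d\}$. $\mathbb{R}[x]_{n,2d}$ is the set of real polynomials in $n$ variables of degree at most $2d$, and $\Sigma[x]_{n,2d}$ is the subset of those that are sums of squares of polynomials in $\mathbb{R}[x]_{n,d}$. The data are $w\in\mathbb{R}^t$ and fixed polynomials $g_i(x)=\sum_{\alpha\in\mathbb{N}^n_{2d}}g_{i,\alpha}x^\alpha\in\mathbb{R}[x]_{n,2d}$, $i=0,1,\dots,t$; the decision variables are $u\in\mathbb{R}^t$ and $s$. Let $N=\binom{n+d}{d}$, $m=\binom{n+2d}{2d}$, and let $v_d(x)=[1,x_1,\dots,x_n,x_1^2,x_1x_2,\dots,x_n^d]^{\mathsf T}$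 be the vector of all monomials of degree at most $d$, whose entries are indexed by $\mathbb{N}^n_d$. For $\alpha\in\mathbb{N}^n_{2d}$, let $B_\alpha$ be the symmetric $N\times N$ matrix, with rows and columns indexed by $\mathbb{N}^n_d$, defined by $(B_\alpha)_{\beta,\gamma}=1$ if $\beta+\gamma=\alpha$ and $0$ otherwise; thus $v_d(x)v_d(x)^{\mathsf T}=\sum_{\alpha\in\mathbb{N}^n_{2d}}B_\alpha x^\alpha$. Writing $s(x)=v_d(x)^{\mathsf T}Xv_d(x)$ with $X\succeq0$ and matching coefficients, the equality constraints become $\langle B_\alpha,X\rangle+\sum_{i=1}^t u_ig_{i,\alpha}=g_{0,\alpha}$ for all $\alpha\in\mathbb{N}^n_{2d}$, where $\langle\cdot,\cdot\rangle$ is the trace inner product. Re-index the multi-indices $\alpha\in\mathbb{N}^n_{2d}$ by integers $1,\dots,m$, and let $\mathrm{vec}$ map a matrix to the stack of its columns. Then $A_1\in\mathbb{R}^{m\times t}$ is the matrix with $(j,i)$ entry $g_{i,j}$ (for $1\le j\le m$, $1\le i\le t$), and $A_2\in\mathbb{R}^{m\times N^2}$ is the matrix whose $j$-th row is $\mathrm{vec}(B_j)^{\mathsf T}$. The constraints read $A\xi=b$ with $A=[A_1,\ A_2]$, $\xi=[u^{\mathsf T},\mathrm{vec}(X)^{\mathsf T}]^{\mathsf T}$, and $b=[g_{0,1},\dots,g_{0,m}]^{\mathsf T}$. The "low rank" term is $A_1A_1^{\mathsf T}$, where $A_1$ has $t$ columns. *)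

theory Defs
  imports "Jordan_Normal_Form.Matrix" "HOL-Library.Poly_Mapping"
begin

text \<open>
  Variables are numbered \<open>0, \<dots>, n - 1\<close>. A multi-index is a finitely supported exponent function, and
  a real polynomial is a finitely supported map from multi-indices to coefficients, whose product
  is the convolution product of finitely supported functions; \<open>Poly_Mapping.single \<alpha> c\<close> is the
  polynomial \<open>c x\<^sup>\<alpha>\<close>.
\<close>

type_synonym multiindex = "nat \<Rightarrow>\<^sub>0 nat"
type_synonym rpoly = "(nat \<Rightarrow>\<^sub>0 nat) \<Rightarrow>\<^sub>0 real"

definition multiindices :: "nat \<Rightarrow> nat \<Rightarrow> multiindex set" where
  "multiindices n k = {\<alpha>. Poly_Mapping.keys \<alpha> \<subseteq> {..<n} \<and> (\<Sum>i<n. Poly_Mapping.lookup \<alpha> i) \<le> k}"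

definition polys :: "nat \<Rightarrow> nat \<Rightarrow> rpoly set" where
  "polys n k = {p. Poly_Mapping.keys p \<subseteq> multiindices n k}"

definition sos_polys :: "nat \<Rightarrow> nat \<Rightarrow> rpoly set" where
  "sos_polys n d = {p \<in> polys n (2 * d). \<exists>qs. set qs \<subseteq> polys n d \<and> p = (\<Sum>q\<leftarrow>qs. q ^ 2)}"

text \<open>
  The feasible pairs \<open>(u, s)\<close> of the sum-of-squares program
  \<open>min w\<^sup>T u\<close> subject to \<open>s = g\<^sub>0 - \<Sum>\<^sub>i u\<^sub>i g\<^sub>i\<close> and \<open>s\<close> a sum of squares. The entries of a vector are
  numbered from 0, so \<open>u\<^sub>i\<close> is the entry at position \<open>i - 1\<close>.
\<close>

definition sos_feasible ::
    "nat \<Rightarrow> nat \<Rightarrow> nat \<Rightarrow> (nat \<Rightarrow> rpoly) \<Rightarrow> real vec \<Rightarrow> rpoly \<Rightarrow> bool" where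
  "sos_feasible n d t g u s \<longleftrightarrow> u \<in> carrier_vec t \<and> s \<in> sos_polys n d \<and>
     s = g 0 - (\<Sum>i=1..t. Poly_Mapping.single 0 (u $ (i - 1)) * g i)"

text \<open>Column-stacking vectorization.\<close>

definition vec_of_mat :: "'a mat \<Rightarrow> 'a vec" where
  "vec_of_mat X = vec (dim_row X * dim_col X) (\<lambda>k. X $$ (k mod dim_row X, k div dim_row X))"

definition psd_mat :: "nat \<Rightarrow> real mat \<Rightarrow> bool" where
  "psd_mat N X \<longleftrightarrow> X \<in> carrier_mat N N \<and> X\<^sup>T = X \<and> (\<forall>z\<in>carrier_vec N. 0 \<le> z \<bullet> (X *\<^sub>v z))"

definition horiz_append :: "'a mat \<Rightarrow> 'a mat \<Rightarrow> 'a mat" where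
  "horiz_append M1 M2 = mat_of_cols (dim_row M1) (cols M1 @ cols M2)"

text \<open>Conic programs \<open>min c\<^sup>T \<xi>\<close> subject to \<open>A \<xi> = b\<close> and \<open>\<xi>\<close> in a given cone.\<close>

record conic_program =
  cost_vec :: "real vec"
  constraint_mat :: "real mat"
  rhs_vec :: "real vec"
  cone :: "real vec set"

definition conic_feasible :: "conic_program \<Rightarrow> real vec \<Rightarrow> bool" where
  "conic_feasible P \<xi> \<longleftrightarrow> \<xi> \<in> cone P \<and> constraint_mat P *\<^sub>v \<xi> = rhs_vec P"

text \<open>
  Below, \<open>bs\<close> lists the multi-indices of degree at most \<open>d\<close> (the order of the entries of the monomial
  vector \<open>v\<^sub>d\<close>, hence of the rows and columns of \<open>B\<^sub>\<alpha>\<close>), and \<open>es\<close> lists those of degree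
  at most \<open>2d\<close> (the order of the equality constraints).
\<close>

definition B_mat :: "multiindex list \<Rightarrow> multiindex \<Rightarrow> real mat" where
  "B_mat bs \<alpha> = mat (length bs) (length bs) (\<lambda>(i, j). if bs ! i + bs ! j = \<alpha> then 1 else 0)"

definition A1_mat :: "multiindex list \<Rightarrow> nat \<Rightarrow> (nat \<Rightarrow> rpoly) \<Rightarrow> real mat" where
  "A1_mat es t g = mat (length es) t (\<lambda>(j, i). Poly_Mapping.lookup (g (i + 1)) (es ! j))"

definition A2_mat :: "multiindex list \<Rightarrow> multiindex list \<Rightarrow> real mat" where
  "A2_mat es bs = mat_of_rows (length bs ^ 2) (map (\<lambda>\<alpha>. vec_of_mat (B_mat bs \<alpha>)) es)"

definition sos_conic_program ::
    "multiindex list \<Rightarrow> multiindex list \<Rightarrow> nat \<Rightarrow> real vec \<Rightarrow> (nat \<Rightarrow> rpoly) \<Rightarrow> conic_program" where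
  "sos_conic_program es bs t w g =
     \<lparr>cost_vec = w @\<^sub>v 0\<^sub>v (length bs ^ 2),
      constraint_mat = horiz_append (A1_mat es t g) (A2_mat es bs),
      rhs_vec = vec (length es) (\<lambda>j. Poly_Mapping.lookup (g 0) (es ! j)),
      cone = {u @\<^sub>v vec_of_mat X | u X. u \<in> carrier_vec t \<and> psd_mat (length bs) X}\<rparr>"


lemma horiz_index:
  assumes "M1 \<in> carrier_mat m p" "M2 \<in> carrier_mat m q" "j < m" "k < p + q"
  shows "horiz_append M1 M2 $$ (j,k) = (if k < p then M1 $$ (j,k) else M2 $$ (j,k - p))"
  using assms by (auto simp: horiz_append_def mat_of_cols_def nth_append)

lemma horiz_carrier:
  assumes "M1 \<in> carrier_mat m p" "M2 \<in> carrier_mat m q"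
  shows "horiz_append M1 M2 \<in> carrier_mat m (p+q)"
  using assms by (auto simp: horiz_append_def)

lemma A1_carrier: "A1_mat es t g \<in> carrier_mat (length es) t"
  by (simp add: A1_mat_def)

lemma A2_carrier: "A2_mat es bs \<in> carrier_mat (length es) (length bs ^ 2)"
  by (auto simp: A2_mat_def mat_of_rows_def)

lemma A2_index:
  assumes "j < length es" "k < length bs ^ 2"
  shows "A2_mat es bs $$ (j,k) =
    (if bs ! (k mod length bs) + bs ! (k div length bs) = es ! j then 1 else 0)"
proof -
  have "k mod length bs < length bs" using assms by (intro mod_less_divisor) (auto intro: Nat.gr0I)
  moreover have "k div length bs < length bs" using assms
    by (simp add: less_mult_imp_div_less power2_eq_square)
  ultimately show ?thesis
  using assms by (simp add: A2_mat_def mat_of_rows_def vec_of_mat_def B_mat_def power2_eq_square)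
qed

lemma card_multiindices: "finite (multiindices n k)" "card (multiindices n k) = (n + k) choose k"
proof -
  let ?L = "{l::nat list. size l = Suc n \<and> sum_list l = k}"
  let ?f = "\<lambda>\<alpha>. map (Poly_Mapping.lookup \<alpha>) [0..<n] @ [k - (\<Sum>i<n. Poly_Mapping.lookup \<alpha> i)]"
  have inj: "inj_on ?f (multiindices n k)"
  proof (rule inj_onI)
    fix a b assume a: "a \<in> multiindices n k" and b: "b \<in> multiindices n k" and e: "?f a = ?f b"
    show "a = b"
    proof (rule poly_mapping_eqI)
      fix i show "Poly_Mapping.lookup a i = Poly_Mapping.lookup b i"
      proof (cases "i < n")
        case True then show ?thesis using e by auto
      next
        case False
        then have "i \<notin> Poly_Mapping.keys a" "i \<notin> Poly_Mapping.keys b" using a b by (auto simp: multiindices_def)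
        then show ?thesis by (simp add: in_keys_iff)
      qed
    qed
  qed
  have img: "?f ` multiindices n k = ?L"
  proof (intro equalityI subsetI)
    fix l assume "l \<in> ?f ` multiindices n k"
    then show "l \<in> ?L" by (auto simp: multiindices_def interv_sum_list_conv_sum_set_nat atLeast0LessThan)
  next
    fix l assume l: "l \<in> ?L"
    define \<alpha> where "\<alpha> = Poly_Mapping.Abs_poly_mapping (\<lambda>i. if i < n then l ! i else 0)"
    have look: "Poly_Mapping.lookup \<alpha> = (\<lambda>i. if i < n then l ! i else 0)"
      unfolding \<alpha>_def by (rule lookup_Abs_poly_mapping) (auto intro: finite_subset[of _ "{..<n}"])
    have "sum_list l = (\<Sum>i<Suc n. l ! i)" using l by (simp add: sum_list_sum_nth atLeast0LessThan)
    then have s: "k = (\<Sum>i<n. l ! i) + l ! n" using l by simp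
    have "\<alpha> \<in> multiindices n k" using s by (auto simp: multiindices_def look in_keys_iff split: if_splits)
    moreover have "l = ?f \<alpha>" using l s
      by (intro nth_equalityI) (auto simp: look nth_append less_Suc_eq)
    ultimately show "l \<in> ?f ` multiindices n k" by blast
  qed
  have "card ?L = (k + n) choose k" using card_length_sum_list[of "Suc n" k] by simp
  then show c: "card (multiindices n k) = (n + k) choose k" using card_image[OF inj] img by (simp add: add.commute)
  show "finite (multiindices n k)"
    by (rule card_ge_0_finite) (simp add: c)
qed

lemma gram_decomp:
  fixes X :: "nat \<Rightarrow> nat \<Rightarrow> real"
  assumes "\<And>i j. i < N \<Longrightarrow> j < N \<Longrightarrow> X i j = X j i"
    and "\<And>z. 0 \<le> (\<Sum>i<N. \<Sum>j<N. z i * z j * X i j)"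
  shows "\<exists>L. \<forall>i<N. \<forall>j<N. X i j = (\<Sum>k<N. L k i * L k j :: real)"
  using assms
proof (induction N arbitrary: X)
  case 0 then show ?case by simp
next
  case (Suc N)
  let ?a = "X N N"
  have sym: "X N i = X i N" if "i < N" for i using Suc.prems(1) that by simp
  have expand: "(\<Sum>i<Suc N. \<Sum>j<Suc N. z i * z j * X i j) =
     (\<Sum>i<N. \<Sum>j<N. z i * z j * X i j) + 2 * z N * (\<Sum>i<N. z i * X i N) + z N * z N * ?a" for z
    by (simp add: sum.distrib sum_distrib_left algebra_simps sym)
  have a0: "?a \<ge> 0"
    using Suc.prems(2)[of "\<lambda>i. if i = N then 1 else 0"] unfolding expand by simp
  show ?case
  proof (cases "?a = 0")
    case True
    have z0: "X i N = 0" if i: "i < N" for i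
    proof (rule ccontr)
      assume ne: "X i N \<noteq> 0"
      define z where "z = (\<lambda>k. if k = i then 1 else if k = N then - (X i i + 1) / (2 * X i N) else 0 :: real)"
      have 1: "(\<Sum>i<N. z i * X i N) = X i N"
      proof -
        have "(\<Sum>k<N. z k * X k N) = (\<Sum>k<N. if k = i then X i N else 0)"
          by (rule sum.cong) (auto simp: z_def)
        then show ?thesis using i by simp
      qed
      have 2: "(\<Sum>k<N. \<Sum>j<N. z k * z j * X k j) = X i i"
      proof -
        have "(\<Sum>k<N. \<Sum>j<N. z k * z j * X k j) = (\<Sum>k<N. if k = i then \<Sum>j<N. if j = i then X i i else 0 else 0)"
        proof (intro sum.cong refl)
          fix k assume "k \<in> {..<N}"
          show "(\<Sum>j<N. z k * z j * X k j) = (if k = i then \<Sum>j<N. if j = i then X i i else 0 else 0)"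
          proof (cases "k = i")
            case True
            have "(\<Sum>j<N. z k * z j * X k j) = (\<Sum>j<N. if j = i then X i i else 0)"
              using True by (intro sum.cong) (auto simp: z_def)
            then show ?thesis using True by simp
          next
            case False
            then have "z k = 0" using \<open>k \<in> {..<N}\<close> by (simp add: z_def)
            then show ?thesis using False by simp
          qed
        qed
        then show ?thesis using i by simp
      qed
      have "0 \<le> X i i + 2 * z N * X i N" using Suc.prems(2)[of z] unfolding expand 1 2 using True by simp
      also have "\<dots> = -1" using i ne by (simp add: z_def field_simps)
      finally show False by simp
    qed
    have "0 \<le> (\<Sum>i<N. \<Sum>j<N. z i * z j * X i j)" for z
      using Suc.prems(2)[of "z"] True z0 unfolding expand by simp
    from Suc.IH[of X, OF _ this] Suc.prems(1) obtain L where
      L: "\<forall>i<N. \<forall>j<N. X i j = (\<Sum>k<N. L k i * L k j)" by auto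
    show ?thesis
      by (rule exI[of _ "\<lambda>k i. if k < N \<and> i < N then L k i else 0"])
         (use L True z0 sym in \<open>auto simp: less_Suc_eq\<close>)
  next
    case False
    then have a: "?a > 0" using a0 by simp
    define Y where "Y = (\<lambda>i j. X i j - X i N * X j N / ?a)"
    have psd: "0 \<le> (\<Sum>i<N. \<Sum>j<N. z i * z j * Y i j)" for z
    proof -
      let ?s = "\<Sum>i<N. z i * X i N"
      have "0 \<le> (\<Sum>i<N. \<Sum>j<N. z i * z j * X i j) + 2 * (- ?s / ?a) * ?s + (- ?s / ?a) * (- ?s / ?a) * ?a"
        using Suc.prems(2)[of "\<lambda>i. if i = N then - ?s / ?a else z i"] unfolding expand by simp
      also have "\<dots> = (\<Sum>i<N. \<Sum>j<N. z i * z j * X i j) - ?s * ?s / ?a"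
        using a by (simp add: field_simps)
      also have "\<dots> = (\<Sum>i<N. \<Sum>j<N. z i * z j * Y i j)"
        by (simp add: Y_def sum_product sum_subtractf sum_divide_distrib algebra_simps)
      finally show ?thesis .
    qed
    from Suc.IH[of Y, OF _ psd] Suc.prems(1) obtain L where
      L: "\<forall>i<N. \<forall>j<N. Y i j = (\<Sum>k<N. L k i * L k j)" by (auto simp: Y_def)
    show ?thesis
      by (rule exI[of _ "\<lambda>k i. if k < N then if i < N then L k i else 0 else X i N / sqrt ?a"])
         (use L a sym in \<open>auto simp: less_Suc_eq Y_def field_simps\<close>)
  qed
qed


text \<open>The polynomial \<open>v\<^sub>d(x)\<^sup>T X v\<^sub>d(x)\<close>.\<close>

definition gram_poly :: "multiindex list \<Rightarrow> real mat \<Rightarrow> rpoly" where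
  "gram_poly bs X = (\<Sum>i<length bs. \<Sum>j<length bs. Poly_Mapping.single (bs ! i + bs ! j) (X $$ (i, j)))"

lemma sum_div_mod:
  fixes f :: "nat \<Rightarrow> nat \<Rightarrow> real"
  shows "(\<Sum>k<N ^ 2. f (k mod N) (k div N)) = (\<Sum>i<N. \<Sum>j<N. f i j)"
proof -
  have "(\<Sum>k<N ^ 2. f (k mod N) (k div N)) = (\<Sum>j<N. \<Sum>k\<in>{j*N..<j*N+N}. f (k mod N) (k div N))"
    using sum.nat_group[of "\<lambda>k. f (k mod N) (k div N)" N N] by (simp only: power2_eq_square)
  also have "\<dots> = (\<Sum>j<N. \<Sum>i<N. f i j)"
  proof (rule sum.cong[OF refl])
    fix j assume "j \<in> {..<N}"
    have "(\<Sum>k\<in>{j*N..<j*N+N}. f (k mod N) (k div N)) = (\<Sum>i\<in>{0..<N}. f ((i+j*N) mod N) ((i+j*N) div N))"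
      using sum.shift_bounds_nat_ivl[of "\<lambda>k. f (k mod N) (k div N)" 0 "j*N" N] by (simp only: add_0 add.commute)
    also have "\<dots> = (\<Sum>i<N. f i j)"
    proof (rule sum.cong)
      fix i assume "i \<in> {..<N}"
      then have "(i + j * N) mod N = i" "(i + j * N) div N = j" by auto
      then show "f ((i+j*N) mod N) ((i+j*N) div N) = f i j" by (simp only:)
    qed (simp only: atLeast0LessThan)
    finally show "(\<Sum>k\<in>{j*N..<j*N+N}. f (k mod N) (k div N)) = (\<Sum>i<N. f i j)" .
  qed
  also have "\<dots> = (\<Sum>i<N. \<Sum>j<N. f i j)" by (rule sum.swap)
  finally show ?thesis .
qed

lemma lookup_const_mult: "Poly_Mapping.lookup (Poly_Mapping.single 0 c * p) a = c * Poly_Mapping.lookup (p :: rpoly) a"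
  by (simp flip: mult_map_scale_conv_mult add: Poly_Mapping.map.rep_eq when_def)

lemma lookup_gram: "Poly_Mapping.lookup (gram_poly bs X) a =
  (\<Sum>i<length bs. \<Sum>j<length bs. (if bs ! i + bs ! j = a then 1 else 0) * X $$ (i, j))"
  by (auto simp: gram_poly_def lookup_sum lookup_single when_def intro!: sum.cong)

lemma constraint_row:
  assumes "u \<in> carrier_vec t" "X \<in> carrier_mat (length bs) (length bs)" "j < length es"
  shows "(constraint_mat (sos_conic_program es bs t w g) *\<^sub>v (u @\<^sub>v vec_of_mat X)) $ j =
    Poly_Mapping.lookup ((\<Sum>i=1..t. Poly_Mapping.single 0 (u $ (i - 1)) * g i) + gram_poly bs X) (es ! j)"
proof -
  let ?A1 = "A1_mat es t g" let ?A2 = "A2_mat es bs" let ?A = "horiz_append ?A1 ?A2"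
  let ?N = "length bs" let ?v = "u @\<^sub>v vec_of_mat X"
  note c = A1_carrier[of es t g] A2_carrier[of es bs] horiz_carrier[OF A1_carrier A2_carrier, of es t g bs]
  have dv: "dim_vec (vec_of_mat X) = ?N^2" using assms by (simp add: vec_of_mat_def power2_eq_square)
  have "(?A *\<^sub>v ?v) $ j = (\<Sum>k = 0..<t + ?N^2. ?A $$ (j,k) * ?v $ k)"
    using c assms dv by (auto simp: scalar_prod_def)
  also have "\<dots> = (\<Sum>k = 0..<t. ?A $$ (j,k) * ?v $ k) + (\<Sum>k = t..<t + ?N^2. ?A $$ (j,k) * ?v $ k)"
    by (simp add: sum.atLeastLessThan_concat)
  also have "(\<Sum>k = t..<t + ?N^2. ?A $$ (j,k) * ?v $ k) = (\<Sum>k<?N^2. ?A $$ (j,k+t) * ?v $ (k+t))"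
    using sum.shift_bounds_nat_ivl[of _ 0 t "?N^2"] by (simp add: add.commute atLeast0LessThan)
  also have "\<dots> = (\<Sum>k<?N^2. (if bs ! (k mod ?N) + bs ! (k div ?N) = es ! j then 1 else 0) * X $$ (k mod ?N, k div ?N))"
    using assms c dv by (intro sum.cong) (auto simp: horiz_index[OF c(1,2)] A2_index vec_of_mat_def power2_eq_square)
  also have "\<dots> = Poly_Mapping.lookup (gram_poly bs X) (es ! j)"
    unfolding sum_div_mod[of "\<lambda>i k. (if bs ! i + bs ! k = es ! j then 1 else 0) * X $$ (i, k)" ?N] lookup_gram ..
  also have "(\<Sum>k = 0..<t. ?A $$ (j,k) * ?v $ k) = (\<Sum>i=1..t. u $ (i - 1) * Poly_Mapping.lookup (g i) (es ! j))"
  proof -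
    have "(\<Sum>k = 0..<t. ?A $$ (j,k) * ?v $ k) = (\<Sum>k = 0..<t. u $ k * Poly_Mapping.lookup (g (k+1)) (es ! j))"
      using assms c dv
    proof (intro sum.cong refl)
      fix k assume "k \<in> {0..<t}"
      then have "?A $$ (j,k) = Poly_Mapping.lookup (g (k+1)) (es ! j)" "?v $ k = u $ k"
        using assms c dv by (simp_all add: horiz_index[OF c(1,2)], simp add: A1_mat_def)
      then show "?A $$ (j,k) * ?v $ k = u $ k * Poly_Mapping.lookup (g (k+1)) (es ! j)" by simp
    qed
    also have "\<dots> = (\<Sum>i=1..t. u $ (i - 1) * Poly_Mapping.lookup (g i) (es ! j))"
      by (rule sum.reindex_bij_witness[of _ "\<lambda>i. i - 1" Suc]) auto
    finally show ?thesis .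
  qed
  finally show ?thesis
    by (simp add: sos_conic_program_def lookup_add lookup_sum lookup_const_mult)
qed

lemma multiindices_add:
  "a \<in> multiindices n k \<Longrightarrow> b \<in> multiindices n l \<Longrightarrow> a + b \<in> multiindices n (k + l)"
  using Poly_Mapping.keys_add[of a b] by (auto simp: multiindices_def lookup_add sum.distrib)

lemma gram_polys:
  assumes "set bs = multiindices n d"
  shows "gram_poly bs X \<in> polys n (2 * d)"
proof -
  have "a \<in> multiindices n (2 * d)" if a: "Poly_Mapping.lookup (gram_poly bs X) a \<noteq> 0" for a
  proof -
    from a obtain i j where ij: "i < length bs" "j < length bs" "bs ! i + bs ! j = a"
      unfolding lookup_gram by (fastforce elim!: sum.not_neutral_contains_not_neutral split: if_splits)
    then have "bs ! i \<in> multiindices n d" "bs ! j \<in> multiindices n d"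
      using assms nth_mem by blast+
    then show ?thesis using multiindices_add ij(3) by (metis mult_2)
  qed
  then show ?thesis by (auto simp: polys_def in_keys_iff)
qed

text \<open>Matching coefficients in \<open>v\<^sub>d(x)\<^sup>T X v\<^sub>d(x) = g\<^sub>0 - \<Sum>\<^sub>i u\<^sub>i g\<^sub>i\<close> is the linear system \<open>A \<xi> = b\<close>.\<close>

lemma conic_constraints_iff:
  assumes "\<forall>i\<in>{0..t}. g i \<in> polys n (2 * d)"
    and "set es = multiindices n (2 * d)" and "set bs = multiindices n d"
    and u: "u \<in> carrier_vec t" and X: "X \<in> carrier_mat (length bs) (length bs)"
  shows "constraint_mat (sos_conic_program es bs t w g) *\<^sub>v (u @\<^sub>v vec_of_mat X) = rhs_vec (sos_conic_program es bs t w g)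
    \<longleftrightarrow> gram_poly bs X = g 0 - (\<Sum>i=1..t. Poly_Mapping.single 0 (u $ (i - 1)) * g i)"
    (is "?A *\<^sub>v ?x = ?b \<longleftrightarrow> ?G = g 0 - ?S")
proof -
  have dA: "dim_row ?A = length es" by (simp add: sos_conic_program_def horiz_append_def A1_mat_def)
  have db: "dim_vec ?b = length es" "\<And>j. j < length es \<Longrightarrow> ?b $ j = Poly_Mapping.lookup (g 0) (es ! j)"
    by (simp_all add: sos_conic_program_def)
  have "?A *\<^sub>v ?x = ?b \<longleftrightarrow> (\<forall>j<length es. (?A *\<^sub>v ?x) $ j = ?b $ j)"
    unfolding vec_eq_iff using dA db(1) by (simp only: dim_mult_mat_vec simp_thms)
  also have "\<dots> \<longleftrightarrow> (\<forall>j<length es. Poly_Mapping.lookup (?S + ?G) (es ! j) = Poly_Mapping.lookup (g 0) (es ! j))"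
    by (simp only: constraint_row[OF u X] db(2) cong: imp_cong)
  also have "\<dots> \<longleftrightarrow> (\<forall>a\<in>set es. Poly_Mapping.lookup (?S + ?G) a = Poly_Mapping.lookup (g 0) a)"
    by (simp only: all_set_conv_all_nth)
  also have "\<dots> \<longleftrightarrow> (\<forall>a. Poly_Mapping.lookup (?S + ?G) a = Poly_Mapping.lookup (g 0) a)"
  proof -
    have out: "Poly_Mapping.lookup p a = 0" if "p \<in> polys n (2*d)" "a \<notin> multiindices n (2 * d)" for p a
      using that by (auto simp: polys_def in_keys_iff)
    have "Poly_Mapping.lookup (?S + ?G) a = Poly_Mapping.lookup (g 0) a" if a: "a \<notin> set es" for a
    proof -
      have z: "Poly_Mapping.lookup (g i) a = 0" if "i \<le> t" for i
        by (rule out) (use assms(1,2) that a in simp_all)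
      moreover have "Poly_Mapping.lookup ?G a = 0" by (rule out[OF gram_polys[OF assms(3)]]) (use a assms(2) in simp)
      ultimately show ?thesis by (simp add: lookup_add lookup_sum lookup_const_mult)
    qed
    then show ?thesis by metis
  qed
  also have "\<dots> \<longleftrightarrow> ?S + ?G = g 0" by (simp only: poly_mapping_eq_iff fun_eq_iff)
  also have "\<dots> \<longleftrightarrow> ?G = g 0 - ?S" by (simp only: eq_diff_eq add.commute)
  finally show ?thesis .
qed

lemma single_sum_const: "(\<Sum>q\<leftarrow>qs. Poly_Mapping.single a (f q)) = Poly_Mapping.single a (\<Sum>q\<leftarrow>qs. f q :: real)"
  by (induction qs) (simp_all add: single_add)

lemma sum_list_swap: "(\<Sum>q\<leftarrow>qs. \<Sum>i\<in>I. f q i) = (\<Sum>i\<in>I. \<Sum>q\<leftarrow>qs. f q i :: 'b::comm_monoid_add)"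
  by (induction qs) (simp_all add: sum.distrib)

lemma sq_expand:
  "(\<Sum>i<N. Poly_Mapping.single (b i) (c i)) ^ 2 = (\<Sum>i<N. \<Sum>j<N. Poly_Mapping.single (b i + b j) (c i * c j :: real))"
  for b :: "nat \<Rightarrow> multiindex"
  by (simp add: power2_eq_square sum_product mult_single)

lemma gram_sum_sq:
  assumes "\<And>i j. i < length bs \<Longrightarrow> j < length bs \<Longrightarrow> X $$ (i,j) = (\<Sum>q\<leftarrow>qs. c q i * c q j)"
  shows "gram_poly bs X = (\<Sum>q\<leftarrow>qs. (\<Sum>i<length bs. Poly_Mapping.single (bs ! i) (c q i)) ^ 2)"
  unfolding sq_expand sum_list_swap single_sum_const gram_poly_def
  using assms by (intro sum.cong refl) auto

lemma quad_form:
  assumes "X \<in> carrier_mat N N" "z \<in> carrier_vec N"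
  shows "z \<bullet> (X *\<^sub>v z) = (\<Sum>i<N. \<Sum>j<N. z $ i * z $ j * X $$ (i, j) :: real)"
proof -
  have "z \<bullet> (X *\<^sub>v z) = (\<Sum>i<N. z $ i * (\<Sum>j<N. X $$ (i, j) * z $ j))"
    using assms by (auto simp: scalar_prod_def atLeast0LessThan intro!: sum.cong)
  also have "\<dots> = (\<Sum>i<N. \<Sum>j<N. z $ i * z $ j * X $$ (i, j))"
    by (intro sum.cong refl) (simp add: sum_distrib_left, intro sum.cong refl, simp)
  finally show ?thesis .
qed

lemma sos_iff_gram:
  assumes bs: "distinct bs" "set bs = multiindices n d"
  shows "s \<in> sos_polys n d \<longleftrightarrow> (\<exists>X. psd_mat (length bs) X \<and> s = gram_poly bs X)"
proof
  let ?N = "length bs"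
  assume "s \<in> sos_polys n d"
  then obtain qs where qs: "set qs \<subseteq> polys n d" "s = (\<Sum>q\<leftarrow>qs. q ^ 2)" by (auto simp: sos_polys_def)
  let ?c = "\<lambda>q i. Poly_Mapping.lookup q (bs ! i)"
  define X where "X = mat ?N ?N (\<lambda>(i,j). \<Sum>q\<leftarrow>qs. ?c q i * ?c q j)"
  have q: "q = (\<Sum>i<?N. Poly_Mapping.single (bs ! i) (?c q i))" if "q \<in> set qs" for q
  proof (rule poly_mapping_eqI)
    fix a
    have "Poly_Mapping.lookup (\<Sum>i<?N. Poly_Mapping.single (bs ! i) (?c q i)) a
      = (\<Sum>b\<in>set bs. if b = a then Poly_Mapping.lookup q b else 0)"
      unfolding lookup_sum lookup_single when_def
      by (rule sum.reindex_bij_betw[OF bij_betw_nth[OF bs(1) refl refl]])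
    also have "\<dots> = Poly_Mapping.lookup q a"
    proof (cases "a \<in> multiindices n d")
      case True
      then show ?thesis by (simp add: bs(2) card_multiindices)
    next
      case False
      then have "a \<notin> Poly_Mapping.keys q" using qs(1) that by (auto simp: polys_def)
      then show ?thesis using False by (simp add: bs(2) card_multiindices in_keys_iff)
    qed
    finally show "Poly_Mapping.lookup q a = Poly_Mapping.lookup (\<Sum>i<?N. Poly_Mapping.single (bs ! i) (?c q i)) a" by simp
  qed
  have "s = gram_poly bs X"
  proof -
    have "gram_poly bs X = (\<Sum>q\<leftarrow>qs. (\<Sum>i<?N. Poly_Mapping.single (bs ! i) (?c q i)) ^ 2)"
      by (rule gram_sum_sq) (simp add: X_def)
    also have "map (\<lambda>q. (\<Sum>i<?N. Poly_Mapping.single (bs ! i) (?c q i)) ^ 2) qs = map (\<lambda>q. q ^ 2) qs"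
      by (rule map_cong[OF refl]) (rule arg_cong[OF q[symmetric]])
    finally show ?thesis using qs(2) by simp
  qed
  moreover have "psd_mat ?N X"
    unfolding psd_mat_def
  proof (intro conjI ballI)
    show c: "X \<in> carrier_mat ?N ?N" by (simp add: X_def)
    show "X\<^sup>T = X" by (rule eq_matI) (auto simp: X_def ac_simps)
    fix z :: "real vec" assume z: "z \<in> carrier_vec ?N"
    have "z \<bullet> (X *\<^sub>v z) = (\<Sum>i<?N. \<Sum>j<?N. \<Sum>q\<leftarrow>qs. (z $ i * ?c q i) * (z $ j * ?c q j))"
      unfolding quad_form[OF c z] by (intro sum.cong refl) (simp add: X_def flip: sum_list_const_mult, simp add: ac_simps)
    also have "\<dots> = (\<Sum>q\<leftarrow>qs. (\<Sum>i<?N. z $ i * ?c q i) ^ 2)"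
      by (simp add: sum_list_swap power2_eq_square sum_product)
    also have "\<dots> \<ge> 0" by (intro sum_list_nonneg) auto
    finally show "0 \<le> z \<bullet> (X *\<^sub>v z)" .
  qed
  ultimately show "\<exists>X. psd_mat (length bs) X \<and> s = gram_poly bs X" by blast
next
  let ?N = "length bs"
  assume "\<exists>X. psd_mat (length bs) X \<and> s = gram_poly bs X"
  then obtain X where X: "psd_mat ?N X" and s: "s = gram_poly bs X" by blast
  have c: "X \<in> carrier_mat ?N ?N" and t: "X\<^sup>T = X" using X by (auto simp: psd_mat_def)
  have sym: "X $$ (i,j) = X $$ (j,i)" if "i < ?N" "j < ?N" for i j
    using that c arg_cong[OF t, of "\<lambda>Y. Y $$ (i,j)"] by simp
  have "0 \<le> (\<Sum>i<?N. \<Sum>j<?N. z i * z j * X $$ (i,j))" for z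
  proof -
    have "0 \<le> vec ?N z \<bullet> (X *\<^sub>v vec ?N z)" using X by (simp add: psd_mat_def)
    then show ?thesis unfolding quad_form[OF c vec_carrier] by simp
  qed
  from gram_decomp[of ?N "\<lambda>i j. X $$ (i,j)", OF sym this] obtain L where
    L: "\<forall>i<?N. \<forall>j<?N. X $$ (i,j) = (\<Sum>k<?N. L k i * L k j)" by blast
  let ?q = "\<lambda>k. \<Sum>i<?N. Poly_Mapping.single (bs ! i) (L k i)"
  have "?q k \<in> polys n d" for k
  proof -
    have "Poly_Mapping.keys (?q k) \<subseteq> (\<Union>i<?N. Poly_Mapping.keys (Poly_Mapping.single (bs ! i) (L k i)))"
      by (rule Poly_Mapping.keys_sum)
    also have "\<dots> \<subseteq> set bs" by (auto split: if_splits)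
    finally show ?thesis using bs by (simp add: polys_def)
  qed
  moreover have "s = (\<Sum>q\<leftarrow>map ?q [0..<?N]. q ^ 2)"
    unfolding s using gram_sum_sq[where bs=bs and X=X and qs="[0..<?N]" and c=L] L
    by (simp add: o_def interv_sum_list_conv_sum_set_nat atLeast0LessThan)
  ultimately show "s \<in> sos_polys n d"
    unfolding sos_polys_def using gram_polys[OF bs(2), of X, folded s]
    by (intro CollectI conjI exI[of _ "map ?q [0..<?N]"]) auto
qed

text \<open>The conic program defined above is equivalent to the sum-of-squares program.\<close>

lemma sos_conic_program_cost:
  assumes "w \<in> carrier_vec t" "u \<in> carrier_vec t" "X \<in> carrier_mat (length bs) (length bs)"
  shows "cost_vec (sos_conic_program es bs t w g) \<bullet> (u @\<^sub>v vec_of_mat X) = w \<bullet> u"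
proof -
  have X: "vec_of_mat X \<in> carrier_vec (length bs ^ 2)"
    using assms(3) by (auto simp: vec_of_mat_def power2_eq_square)
  have "(w @\<^sub>v 0\<^sub>v (length bs ^ 2)) \<bullet> (u @\<^sub>v vec_of_mat X) = w \<bullet> u + 0\<^sub>v (length bs ^ 2) \<bullet> vec_of_mat X"
    by (rule scalar_prod_append[OF assms(1) zero_carrier_vec assms(2) X])
  then show ?thesis using X by (simp add: sos_conic_program_def)
qed

lemma sos_conic_program_correct:
  assumes "\<forall>i\<in>{0..t}. g i \<in> polys n (2 * d)"
    and "set es = multiindices n (2 * d)" and "distinct bs" and "set bs = multiindices n d"
    and u: "u \<in> carrier_vec t"
  shows "(\<exists>s. sos_feasible n d t g u s) \<longleftrightarrow>
    (\<exists>X. psd_mat (length bs) X \<and> conic_feasible (sos_conic_program es bs t w g) (u @\<^sub>v vec_of_mat X))"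
proof -
  let ?P = "sos_conic_program es bs t w g"
  let ?r = "g 0 - (\<Sum>i=1..t. Poly_Mapping.single 0 (u $ (i - 1)) * g i)"
  have "(\<exists>s. sos_feasible n d t g u s) \<longleftrightarrow> ?r \<in> sos_polys n d"
    unfolding sos_feasible_def using u by blast
  also have "\<dots> \<longleftrightarrow> (\<exists>X. psd_mat (length bs) X \<and> gram_poly bs X = ?r)"
    unfolding sos_iff_gram[OF assms(3,4)] by (simp only: eq_commute)
  also have "\<dots> \<longleftrightarrow> (\<exists>X. psd_mat (length bs) X \<and> conic_feasible ?P (u @\<^sub>v vec_of_mat X))"
  proof (rule ex_cong1, rule conj_cong[OF refl])
    fix X assume X: "psd_mat (length bs) X"
    then have "X \<in> carrier_mat (length bs) (length bs)" by (simp add: psd_mat_def)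
    note * = conic_constraints_iff[OF assms(1,2,4) u this, of w]
    have "cone ?P = {u @\<^sub>v vec_of_mat X | u X. u \<in> carrier_vec t \<and> psd_mat (length bs) X}"
      by (simp add: sos_conic_program_def)
    then have "u @\<^sub>v vec_of_mat X \<in> cone ?P" using u X by blast
    then show "gram_poly bs X = ?r \<longleftrightarrow> conic_feasible ?P (u @\<^sub>v vec_of_mat X)"
      unfolding conic_feasible_def * by (simp only: simp_thms)
  qed
  finally show ?thesis .
qed

end

theory Submission
  imports Defs
begin

text \<open>Entry \<open>(i, j)\<close> of a Gram matrix \<open>M * M\<^sup>T\<close> is the inner
  product of rows \<open>i\<close> and \<open>j\<close>; for concatenated rows it splits at column
  \<open>p\<close> into one inner product per block.\<close>

lemma horiz_append_times_transpose:
  fixes M1 M2 :: "'a :: comm_semiring_0 mat"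
  assumes M: "M1 \<in> carrier_mat m p" "M2 \<in> carrier_mat m q"
  shows "horiz_append M1 M2 * (horiz_append M1 M2)\<^sup>T = M2 * M2\<^sup>T + M1 * M1\<^sup>T"
proof (rule eq_matI)
  let ?A = "horiz_append M1 M2"
  note A = horiz_carrier[OF M]
  fix i j assume "i < dim_row (M2 * M2\<^sup>T + M1 * M1\<^sup>T)" "j < dim_col (M2 * M2\<^sup>T + M1 * M1\<^sup>T)"
  then have ij: "i < m" "j < m" using M by auto
  have "(?A * ?A\<^sup>T) $$ (i, j) = (\<Sum>k = 0..<p + q. ?A $$ (i, k) * ?A $$ (j, k))"
    using A ij by (auto simp: scalar_prod_def)
  \<comment> \<open>The range is cut at \<open>p\<close> and its upper part shifted down to start at
    0, so that \<open>k + p\<close> addresses column \<open>k\<close> of \<open>M2\<close>.\<close>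
  also have "\<dots> = (\<Sum>k = 0..<p. ?A $$ (i, k) * ?A $$ (j, k))
      + (\<Sum>k = 0..<q. ?A $$ (i, k + p) * ?A $$ (j, k + p))"
    using sum.atLeastLessThan_concat[of 0 p "p + q" "\<lambda>k. ?A $$ (i, k) * ?A $$ (j, k)"]
      sum.shift_bounds_nat_ivl[of "\<lambda>k. ?A $$ (i, k) * ?A $$ (j, k)" 0 p q]
    by (simp add: add.commute)
  also have "\<dots> = (\<Sum>k = 0..<p. M1 $$ (i, k) * M1 $$ (j, k))
      + (\<Sum>k = 0..<q. M2 $$ (i, k) * M2 $$ (j, k))"
    using ij by (simp add: horiz_index[OF M])
  also have "\<dots> = (M2 * M2\<^sup>T + M1 * M1\<^sup>T) $$ (i, j)"
    using M ij by (simp add: scalar_prod_def add.commute)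
  finally show "(?A * ?A\<^sup>T) $$ (i, j) = (M2 * M2\<^sup>T + M1 * M1\<^sup>T) $$ (i, j)" .
qed (use M horiz_carrier[OF M] in auto)

text \<open>Each pair \<open>(\<beta>, \<gamma>)\<close> has only one sum \<open>\<beta> + \<gamma>\<close>, so the matrices \<open>B\<^sub>\<alpha>\<close> have
  pairwise disjoint supports and the rows of \<open>A\<^sub>2\<close> are orthogonal.\<close>

lemma diagonal_A2_mat_times_transpose:
  assumes "distinct es"
  shows "diagonal_mat (A2_mat es bs * (A2_mat es bs)\<^sup>T)"
  unfolding diagonal_mat_def
proof (intro allI impI)
  let ?A2 = "A2_mat es bs"
  note c = A2_carrier[of es bs]
  fix i j
  assume "i < dim_row (?A2 * ?A2\<^sup>T)" "j < dim_col (?A2 * ?A2\<^sup>T)" and ne: "i \<noteq> j"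
  then have ij: "i < length es" "j < length es" using c by auto
  then have es: "es ! i \<noteq> es ! j" using assms ne by (simp add: nth_eq_iff_index_eq)
  have "(?A2 * ?A2\<^sup>T) $$ (i, j) = (\<Sum>k = 0..<length bs ^ 2. ?A2 $$ (i, k) * ?A2 $$ (j, k))"
    using c ij by (auto simp: scalar_prod_def)
  \<comment> \<open>Column \<open>k\<close> encodes the pair of positions
    \<open>(k mod length bs, k div length bs)\<close>. The sum of the two multi-indices there cannot
    equal both \<open>es ! i\<close> and \<open>es ! j\<close>, so one factor of each summand is
    0.\<close>
  also have "\<dots> = 0"
    using ij es by (intro sum.neutral) (auto simp: A2_index)
  finally show "(?A2 * ?A2\<^sup>T) $$ (i, j) = 0" .
qed

text \<open>\<open>es\<close> and \<open>bs\<close> are arbitrary repetition-free enumerations, so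
  the result holds for every ordering of constraints and monomials.\<close>

theorem proposition1:
  fixes n d t :: nat
    and w :: "real vec"
    and g :: "nat \<Rightarrow> rpoly"
    and es bs :: "multiindex list"
  assumes "w \<in> carrier_vec t"
    and "\<forall>i\<in>{0..t}. g i \<in> polys n (2 * d)"
    and "distinct es" and "set es = multiindices n (2 * d)"
    and "distinct bs" and "set bs = multiindices n d"
  shows "let m = (n + 2 * d) choose (2 * d);
             N = (n + d) choose d;
             A1 = A1_mat es t g;
             A2 = A2_mat es bs;
             A = constraint_mat (sos_conic_program es bs t w g);
             D = A2 * A2\<^sup>T
         in A1 \<in> carrier_mat m t \<and> A2 \<in> carrier_mat m (N ^ 2) \<and> A \<in> carrier_mat m (t + N ^ 2) \<and>
            A * A\<^sup>T \<in> carrier_mat m m \<and>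
            diagonal_mat D \<and> A * A\<^sup>T = D + A1 * A1\<^sup>T"
proof -
  have m: "length es = (n + 2 * d) choose (2 * d)"
    using distinct_card[OF assms(3)] assms(4) card_multiindices(2) by simp
  have N: "length bs = (n + d) choose d"
    using distinct_card[OF assms(5)] assms(6) card_multiindices(2) by simp
  let ?A1 = "A1_mat es t g" and ?A2 = "A2_mat es bs"
  have A: "constraint_mat (sos_conic_program es bs t w g) = horiz_append ?A1 ?A2"
    by (simp add: sos_conic_program_def)
  note c = A1_carrier[of es t g] A2_carrier[of es bs]
  show ?thesis
    \<comment> \<open>The binomials are turned back into list lengths, the form in which the carrier
      facts are stated.\<close>
    unfolding Let_def A m[symmetric] N[symmetric]
    using c horiz_carrier[OF c] diagonal_A2_mat_times_transpose[OF assms(3)]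
      horiz_append_times_transpose[OF c]
    by simp
qed

end
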